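(* Let $\mathcal{H}$ and $\mathcal{G}$ be real Hilbert spaces, let $A\colon\mathcal{H}\to2^{\mathcal{H}}$ and $B\colon\mathcal{G}\to2^{\mathcal{G}}$ be maximally monotone operators, and let $L\colon\mathcal{H}\to\mathcal{G}$ be a non-zero linear bounded operator. Assume that $$\boldsymbol{Z}=\{(\hat x,\hat u)\in\mathcal{H}\times\mathcal{G}\ :\ 0\in A\hat x+L^*\hat u,\ 0\in B^{-1}\hat u-L\hat x\}$$ is non-empty. Let $\Sigma\colon\mathcal{G}\to\mathcal{G}$ and $\Upsilon\colon\mathcal{H}\to\mathcal{H}$ be strongly monotone self-adjoint linear operators such that $U=\Upsilon^{-1}-L^*\Sigma L$ is monotone. Let $(x_0,u_0)\in\mathcal{H}\times\mathcal{G}$ and let $\big((x_n,u_n)\big)_{n\in\mathbb{N}}$ be defined by the recurrence (Split-Douglas-Rachford): for every $n\in\mathbb{N}$, $$\begin{aligned} v_n&=\Sigma(\mathrm{Id}-J_{\Sigma^{-1}B})(Lx_n+\Sigma^{-1}u_n),\\ z_n&=x_n-\Upsilon L^*v_n,\\ x_{n+1}&=J_{\Upsilon A}z_n,\\ u_{n+1}&=\Sigma L(x_{n+1}-x_n)+v_n.\end{aligned}$$ Then the following assertions hold: (i) $\sum_{n\ge1}\|x_{n+1}-x_n\|^2<+\infty$ and $\sum_{n\ge1}\|u_{n+1}-u_n\|^2<+\infty$. (ii) There exists $(\hat x,\hat u)\in\boldsymbol{Z}$ such that $(x_n,u_n)\rightharpoonup(\hat x,\hat u)$ weakly in $\ma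thcal{H}\oplus\mathcal{G}$.
   Context: A linear self-adjoint operator $\Upsilon$ is strongly monotone if there is $\beta>0$ with $\langle x\mid\Upsilon x\rangle\ge\beta\|x\|^2$ for all $x$. For a set-valued operator $M$, $M^{-1}u=\{x:u\in Mx\}$ and the resolvent is $J_M=(\mathrm{Id}+M)^{-1}$; in particular $J_{\Upsilon A}=(\mathrm{Id}+\Upsilon A)^{-1}$ and $J_{\Sigma^{-1}B}=(\mathrm{Id}+\Sigma^{-1}B)^{-1}$, which are single-valued and everywhere defined here. $L^*$ is the adjoint of $L$; $\mathcal{H}\oplus\mathcal{G}$ is the Hilbert direct sum; $\rightharpoonup$ denotes weak convergence. *)

theory Defs
  imports "HOL-Analysis.Analysis"
begin

text \<open>
  Real Hilbert spaces are types of sort \<open>{real_inner, complete_space}\<close>. A set-valued operator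
  \<open>M : H \<rightarrow> 2\<^sup>H\<close> is a function \<open>M :: 'a \<Rightarrow> 'a set\<close> whose values may be empty.
\<close>

definition monotone_operator :: "('a::real_inner \<Rightarrow> 'a set) \<Rightarrow> bool" where
  "monotone_operator M \<longleftrightarrow>
     (\<forall>x y. \<forall>u \<in> M x. \<forall>v \<in> M y. 0 \<le> inner (x - y) (u - v))"

text \<open>Maximality is with respect to inclusion of graphs.\<close>

definition maximally_monotone :: "('a::real_inner \<Rightarrow> 'a set) \<Rightarrow> bool" where
  "maximally_monotone M \<longleftrightarrow> monotone_operator M \<and>
     (\<forall>N. monotone_operator N \<and> (\<forall>x. M x \<subseteq> N x) \<longrightarrow> N = M)"

definition op_inverse :: "('a \<Rightarrow> 'b set) \<Rightarrow> 'b \<Rightarrow> 'a set" where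
  "op_inverse M u = {x. u \<in> M x}"

text \<open>
  The resolvent \<open>(Id + M)\<^sup>-\<^sup>1\<close> as a function. Its value at \<open>z\<close> is the unique element of the set
  \<open>(Id + M)\<^sup>-\<^sup>1 z\<close>; it is meaningful only where that set is a singleton.
\<close>

definition resolvent :: "('a::real_vector \<Rightarrow> 'a set) \<Rightarrow> 'a \<Rightarrow> 'a" where
  "resolvent M z = the_elem (op_inverse (\<lambda>x. {x + y | y. y \<in> M x}) z)"

text \<open>
  Symmetry is stated directly, because \<open>adjoint T\<close> is defined by a choice operator and is
  unspecified unless an adjoint is known to exist. Boundedness is not required here; it follows
  from the Hellinger-Toeplitz theorem.
\<close>

definition self_adjoint_linear :: "('a::real_inner \<Rightarrow> 'a) \<Rightarrow> bool" where
  "self_adjoint_linear T \<longleftrightarrow> linear T \<and> (\<forall>x y. inner (T x) y = inner x (T y))"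

definition strongly_monotone :: "('a::real_inner \<Rightarrow> 'a) \<Rightarrow> bool" where
  "strongly_monotone T \<longleftrightarrow> (\<exists>\<beta>>0. \<forall>x. inner x (T x) \<ge> \<beta> * (norm x)\<^sup>2)"

text \<open>The set \<open>Z\<close>: pairs with \<open>0 \<in> A x + L\<^sup>* u\<close> and \<open>0 \<in> B\<^sup>-\<^sup>1 u - L x\<close>.\<close>

definition primal_dual_solutions ::
  "('a::real_inner \<Rightarrow> 'a set) \<Rightarrow> ('b::real_inner \<Rightarrow> 'b set) \<Rightarrow> ('a \<Rightarrow> 'b) \<Rightarrow> ('a \<times> 'b) set" where
  "primal_dual_solutions A B L =
     {(x, u). 0 \<in> {a + adjoint L u | a. a \<in> A x} \<and> 0 \<in> {y - L x | y. y \<in> op_inverse B u}}"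

text \<open>
  Weak convergence in a Hilbert space, continuous linear functionals being given by inner products.
  On a product type, \<open>inner\<close> is the inner product of the Hilbert direct sum.
\<close>

definition weakly_converges :: "(nat \<Rightarrow> 'a::real_inner) \<Rightarrow> 'a \<Rightarrow> bool" where
  "weakly_converges s l \<longleftrightarrow> (\<forall>y. (\<lambda>n. inner (s n) y) \<longlonglongrightarrow> inner l y)"

end

theory Submission
  imports Defs
begin

text \<open>
  Write \<open>d\<^sub>n = x\<^sub>n\<^sub>+\<^sub>1 - x\<^sub>n\<close> and \<open>w\<^sub>n = v\<^sub>n - u\<^sub>n\<close>. Monotonicity of \<open>A\<close> and \<open>B\<close> between the current
  iterate and a solution shows that the iterates are Fejer monotone for the inner product given by
  \<open>\<Upsilon>\<^sup>-\<^sup>1 \<oplus> \<Sigma>\<^sup>-\<^sup>1\<close>, with decrement \<open>\<langle>U d\<^sub>n, d\<^sub>n\<rangle> + \<langle>w\<^sub>n, \<Sigma>\<^sup>-\<^sup>1 w\<^sub>n\<rangle>\<close>. As \<open>U\<close> may be degenerate, this does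
  not yet bound \<open>d\<^sub>n\<close>; monotonicity of \<open>A\<close> between \<open>x\<^sub>n\<^sub>+\<^sub>1\<close> and \<open>x\<^sub>n\<^sub>+\<^sub>2\<close> bounds \<open>\<parallel>d\<^sub>n\<^sub>+\<^sub>1\<parallel>\<^sup>2\<close> by
  the decrements at \<open>n\<close> and \<open>n + 1\<close>. Weak cluster points are solutions by maximality, and Opial's
  argument gives weak convergence. That the resolvents are defined everywhere is Minty's theorem,
  obtained by minimizing the Fitzpatrick function plus a quadratic form (Simons and Zalinescu).
\<close>

section \<open>Self-adjoint strongly monotone operators\<close>

lemma self_adjoint_linearD:
  assumes "self_adjoint_linear T"
  shows "linear T" "inner (T x) y = inner x (T y)"
  using assms by (auto simp: self_adjoint_linear_def)

lemma strongly_monotoneE: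
  assumes "strongly_monotone T"
  obtains \<beta> where "\<beta> > 0" "\<And>x. \<beta> * (norm x)\<^sup>2 \<le> inner x (T x)"
  using assms by (auto simp: strongly_monotone_def)

section \<open>Automatic boundedness of symmetric operators\<close>

lemma norm_le_of_inner_bound:
  fixes x :: "'a::real_inner"
  assumes "0 \<le> c" "\<And>y. norm y \<le> 1 \<Longrightarrow> inner x y \<le> c"
  shows "norm x \<le> c"
proof (cases "x = 0")
  case False
  have "inner x (x /\<^sub>R norm x) \<le> c"
    by (rule assms(2)) (use False in simp)
  then show ?thesis
    using False by (simp add: dot_square_norm power2_eq_square flip: mult.assoc)
qed (use assms(1) in simp)

text \<open>Symmetry makes each sublevel set \<open>E k\<close> of \<open>norm (T x)\<close> an
  intersection of half-spaces, hence closed although continuity of \<open>T\<close> is not yet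
  known. These sets cover the space, so by Baire's theorem one of them contains a ball.\<close>

theorem Hellinger_Toeplitz:
  fixes T :: "'a::{real_inner, complete_space} \<Rightarrow> 'a"
  assumes "self_adjoint_linear T"
  shows "bounded_linear T"
proof -
  note lin = self_adjoint_linearD(1)[OF assms] and sym = self_adjoint_linearD(2)[OF assms]
  define E where "E k = {x. norm (T x) \<le> real k}" for k :: nat
  have E_eq: "E k = (\<Inter>y\<in>cball 0 1. {x. inner x (T y) \<le> real k})" for k
  proof (intro set_eqI iffI)
    fix x assume "x \<in> E k"
    then have "inner (T x) y \<le> real k" if "norm y \<le> 1" for y
      using norm_cauchy_schwarz[of "T x" y] mult_left_le[OF that, of "norm (T x)"]
      by (simp add: E_def)
    then show "x \<in> (\<Inter>y\<in>cball 0 1. {x. inner x (T y) \<le> real k})"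
      by (simp add: sym)
  next
    fix x assume "x \<in> (\<Inter>y\<in>cball 0 1. {x. inner x (T y) \<le> real k})"
    then show "x \<in> E k"
      unfolding E_def by (auto simp flip: sym intro!: norm_le_of_inner_bound)
  qed
  have E_closed: "closed (E k)" for k
    unfolding E_eq by (intro closed_INT ballI closed_Collect_le continuous_intros)
  have "\<exists>k. interior (E k) \<noteq> {}"
  proof (rule ccontr)
    assume *: "\<not> (\<exists>k. interior (E k) \<noteq> {})"
    have "euclidean interior_of (\<Union>(range E)) = {}"
      using completely_metrizable_space_euclidean E_closed *
      by (intro Baire_category_alt) auto
    moreover have "\<Union>(range E) = UNIV"
      using real_arch_simple by (auto simp: E_def)
    ultimately show False by simp
  qed
  then obtain k x0 where "x0 \<in> interior (E k)" by blast
  then obtain r where r: "r > 0" "cball x0 r \<subseteq> E k"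
    by (meson mem_interior_cball)
  show ?thesis
  proof (rule bounded_linear_intro[where K = "2 * real k / r"])
    show "T (x + y) = T x + T y" for x y using lin by (rule linear_add)
    show "T (c *\<^sub>R x) = c *\<^sub>R T x" for c x using lin by (rule linear_cmul)
    show "norm (T x) \<le> norm x * (2 * real k / r)" for x
    proof (cases "x = 0")
      case False
      \<comment> \<open>Scaling \<open>x\<close> to length \<open>r\<close> keeps
        \<open>x0 + h\<close> in the ball; \<open>T h\<close> is then a difference of two vectors of
        norm at most \<open>k\<close>, whence the constant \<open>2 * k / r\<close>.\<close>
      define h where "h = (r / norm x) *\<^sub>R x"
      have "norm h = r" using False r(1) by (simp add: h_def)
      then have "x0 + h \<in> cball x0 r" "x0 \<in> cball x0 r" using r(1) by (auto simp: dist_norm)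
      then have "x0 + h \<in> E k" "x0 \<in> E k" using r(2) by blast+
      then have "norm (T (x0 + h)) \<le> k" "norm (T x0) \<le> k" by (simp_all add: E_def)
      then have "norm (T h) \<le> 2 * k"
        using norm_triangle_ineq4[of "T (x0 + h)" "T x0"] by (simp add: linear_add[OF lin])
      then have "r / norm x * norm (T x) \<le> 2 * k"
        using r(1) by (simp add: h_def linear_cmul[OF lin])
      then show ?thesis using False r(1) by (simp add: field_simps)
    qed (simp add: linear_0[OF lin])
  qed
qed

text \<open>The near-minimal sets \<open>S n\<close> are closed and nested, and the midpoint
  inequality makes their diameters shrink to 0, so completeness alone yields a common point. The set
  \<open>D\<close> plays the role of the effective domain, and closed sublevel sets express lower
  semicontinuity.\<close>

lemma strongly_convex_minimizer:
  fixes h :: "'a::{real_normed_vector, complete_space} \<Rightarrow> real"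
  assumes "D \<noteq> {}" "c > 0"
    and mid: "\<And>x y. x \<in> D \<Longrightarrow> y \<in> D \<Longrightarrow> midpoint x y \<in> D \<and>
               h (midpoint x y) \<le> (h x + h y) / 2 - c * (norm (x - y))\<^sup>2"
    and bdd: "\<And>x. x \<in> D \<Longrightarrow> m \<le> h x"
    and lsc: "\<And>r. closed {x \<in> D. h x \<le> r}"
  obtains p where "p \<in> D" "\<And>x. x \<in> D \<Longrightarrow> h p \<le> h x"
proof -
  define I where "I = Inf (h ` D)"
  define S where "S n = {x \<in> D. h x \<le> I + inverse (real (Suc n))}" for n
  have I: "I \<le> h x" if "x \<in> D" for x
    unfolding I_def by (rule cInf_lower) (use that bdd in \<open>auto intro: bdd_belowI2[of _ m]\<close>)
  have ne: "S n \<noteq> {}" for n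
  proof -
    have "Inf (h ` D) < I + inverse (real (Suc n))" unfolding I_def by simp
    then obtain x where "x \<in> D" "h x < I + inverse (real (Suc n))"
      using cInf_lessD[of "h ` D"] \<open>D \<noteq> {}\<close> by blast
    then show ?thesis by (auto simp: S_def intro: less_imp_le)
  qed
  have mono: "S n \<subseteq> S k" if "k \<le> n" for k n
  proof -
    have "inverse (real (Suc n)) \<le> inverse (real (Suc k))"
      using that by (intro le_imp_inverse_le) auto
    then have "I + inverse (real (Suc n)) \<le> I + inverse (real (Suc k))" by (rule add_left_mono)
    then show ?thesis unfolding S_def by (blast intro: order_trans)
  qed
  have small: "\<exists>n. \<forall>x\<in>S n. \<forall>y\<in>S n. dist x y < e" if "e > 0" for e
  proof -
    have "0 < c * e\<^sup>2" using \<open>c > 0\<close> \<open>e > 0\<close> by simp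
    then obtain n where n: "inverse (real (Suc n)) < c * e\<^sup>2"
      using reals_Archimedean by blast
    have "dist x y < e" if "x \<in> S n" "y \<in> S n" for x y
    proof -
      have xy: "x \<in> D" "y \<in> D" "h x \<le> I + inverse (real (Suc n))" "h y \<le> I + inverse (real (Suc n))"
        using that by (simp_all add: S_def)
      have "c * (norm (x - y))\<^sup>2 \<le> inverse (real (Suc n))"
      \<comment> \<open>The midpoint value is at least \<open>I\<close> and the mean of the endpoint
        values at most \<open>I\<close> plus the tolerance, which leaves only the tolerance for the
        quadratic gap.\<close>
      proof -
        have "d \<le> e" if "m' \<le> (a + b) / 2 - d" "I \<le> m'" "a \<le> I + e" "b \<le> I + e" for a b d e m' :: real
          using that by argo
        then show ?thesis
          using mid[OF xy(1,2), THEN conjunct2] I[OF mid[OF xy(1,2), THEN conjunct1]] xy(3,4) by blast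
      qed
      with n have "c * (norm (x - y))\<^sup>2 < c * e\<^sup>2" by linarith
      then have "(norm (x - y))\<^sup>2 < e\<^sup>2" using \<open>c > 0\<close> by simp
      then show ?thesis
        using \<open>e > 0\<close> by (simp add: dist_norm power2_less_imp_less)
    qed
    then show ?thesis by blast
  qed
  obtain p where p: "\<And>n. p \<in> S n"
    by (rule decreasing_closed_nest[of S]) (use lsc ne mono small in \<open>auto simp: S_def\<close>)
  have "h p \<le> I"
  proof (rule field_le_epsilon)
    fix e :: real assume "e > 0"
    then obtain n where "inverse (real (Suc n)) < e" using reals_Archimedean by blast
    then show "h p \<le> I + e" using p[of n] by (auto simp: S_def)
  qed
  then show thesis
    using that[of p] p[of 0] I by (force simp: S_def)
qed

section \<open>Minimizing a supremum of affine functions plus a quadratic form\<close>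

lemma quadratic_expand:
  assumes "linear T" "\<And>x y. inner (T x) y = inner x (T y)"
  shows "inner (p + t *\<^sub>R d) (T (p + t *\<^sub>R d)) =
         inner p (T p) + 2 * t * inner (T p) d + t\<^sup>2 * inner d (T d)"
  using assms(2)[of p d] assms(2)[of d p]
  by (simp add: linear_add[OF assms(1)] linear_cmul[OF assms(1)] inner_add_left inner_add_right
      inner_commute power2_eq_square algebra_simps)

text \<open>The common source of the Riesz representation, of the invertibility of strongly monotone
  operators and of Minty's theorem.\<close>

lemma sup_affine_plus_quadratic_minimizer:
  fixes T :: "'a::{real_inner, complete_space} \<Rightarrow> 'a" and f :: "'i \<Rightarrow> 'a \<Rightarrow> real"
  assumes T: "self_adjoint_linear T" "strongly_monotone T"
    and I: "I \<noteq> {}" and f: "\<And>i. i \<in> I \<Longrightarrow> bounded_linear (f i)"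
    and q': "\<And>i. i \<in> I \<Longrightarrow> f i q' + c i \<le> r'"
  obtains p s where "\<And>i. i \<in> I \<Longrightarrow> f i p + c i \<le> s"
    "\<And>q r. (\<And>i. i \<in> I \<Longrightarrow> f i q + c i \<le> r) \<Longrightarrow> s + inner (T p) (p - q) \<le> r"
proof -
  note lin = self_adjoint_linearD(1)[OF T(1)] and sym = self_adjoint_linearD(2)[OF T(1)]
  note quad = quadratic_expand[OF lin sym]
  obtain \<beta> where \<beta>: "\<beta> > 0" "\<And>x. \<beta> * (norm x)\<^sup>2 \<le> inner x (T x)"
    using T(2) by (rule strongly_monotoneE) blast
  have Tb: "bounded_linear T" using T(1) by (rule Hellinger_Toeplitz)
  \<comment> \<open>\<open>D\<close> is the effective domain: only there is the real-valued
    \<open>SUP\<close> in \<open>F\<close> a true supremum.\<close>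
  define D where "D = {x. \<exists>r. \<forall>i\<in>I. f i x + c i \<le> r}"
  define F where "F x = (SUP i\<in>I. f i x + c i)" for x
  define h where "h x = F x + inner x (T x) / 2" for x
  have bdd: "bdd_above ((\<lambda>i. f i x + c i) ` I)" if "x \<in> D" for x
    using that by (auto simp: D_def bdd_above_def)
  have upper: "f i x + c i \<le> F x" if "x \<in> D" "i \<in> I" for x i
    unfolding F_def using bdd[OF that(1)] that(2) by (intro cSUP_upper) auto
  have least: "F x \<le> r" if "\<And>i. i \<in> I \<Longrightarrow> f i x + c i \<le> r" for x r
    unfolding F_def using that I by (intro cSUP_least) auto
  have D_I: "x \<in> D" if "\<And>i. i \<in> I \<Longrightarrow> f i x + c i \<le> r" for x r
    using that by (auto simp: D_def)
  have conv: "f i (x + t *\<^sub>R (y - x)) + c i \<le> (1 - t) * F x + t * r"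
    if "x \<in> D" "\<And>i. i \<in> I \<Longrightarrow> f i y + c i \<le> r" "i \<in> I" "0 \<le> t" "t \<le> 1" for x y t r i
  proof -
    interpret fi: bounded_linear "f i" using f that(3) .
    have "f i (x + t *\<^sub>R (y - x)) + c i = (1 - t) * (f i x + c i) + t * (f i y + c i)"
      by (simp add: fi.add fi.scaleR fi.diff algebra_simps)
    also have "\<dots> \<le> (1 - t) * F x + t * r"
      using that upper[OF that(1,3)] by (intro add_mono mult_left_mono) auto
    finally show ?thesis .
  qed
  have mid_eq: "midpoint x y = x + (1/2) *\<^sub>R (y - x)" for x y :: 'a
    by (simp add: midpoint_def algebra_simps flip: scaleR_add_left)
  \<comment> \<open>Half the quadratic form drops at a midpoint by one eighth of its value at
    \<open>y - x\<close>; the supremum \<open>F\<close> contributes only convexity.\<close>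
  have h_mid: "midpoint x y \<in> D \<and> h (midpoint x y) \<le> (h x + h y) / 2 - (\<beta> / 8) * (norm (x - y))\<^sup>2"
    if "x \<in> D" "y \<in> D" for x y
  proof -
    have *: "f i (midpoint x y) + c i \<le> (1 - 1/2) * F x + (1/2) * F y" if "i \<in> I" for i
      unfolding mid_eq using \<open>x \<in> D\<close> \<open>y \<in> D\<close> upper that by (intro conv) auto
    have "inner y (T y) = inner x (T x) + 2 * inner (T x) (y - x) + inner (y - x) (T (y - x))"
      using quad[of x 1 "y - x"] by simp
    moreover have "inner (midpoint x y) (T (midpoint x y)) =
      inner x (T x) + inner (T x) (y - x) + inner (y - x) (T (y - x)) / 4"
      unfolding mid_eq using quad[of x "1/2" "y - x"] by (simp add: power2_eq_square)
    moreover have "\<beta> * (norm (x - y))\<^sup>2 \<le> inner (y - x) (T (y - x))"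
      using \<beta>(2)[of "y - x"] by (simp add: norm_minus_commute)
    moreover have "F (midpoint x y) \<le> (F x + F y) / 2"
      using least[OF *] by simp
    ultimately have "h (midpoint x y) \<le> (h x + h y) / 2 - (\<beta> / 8) * (norm (x - y))\<^sup>2"
      unfolding h_def by argo
    then show ?thesis using D_I[OF *] by blast
  qed
  obtain i0 where i0: "i0 \<in> I" using I by blast
  obtain K where K: "\<And>x. \<bar>f i0 x\<bar> \<le> norm x * K"
    using bounded_linear.bounded[OF f[OF i0]] by auto
  \<comment> \<open>A single affine minorant bounds \<open>F\<close> from below; its slope, at most
    \<open>K\<close>, is absorbed by the quadratic term on completing the square.\<close>
  have h_bdd: "c i0 - K\<^sup>2 / (2 * \<beta>) \<le> h x" if "x \<in> D" for x
  proof -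
    have "0 \<le> (\<beta> * norm x - K)\<^sup>2 / (2 * \<beta>)" using \<beta>(1) by simp
    also have "\<dots> = \<beta> * (norm x)\<^sup>2 / 2 - norm x * K + K\<^sup>2 / (2 * \<beta>)"
      using \<beta>(1) by (simp add: power2_eq_square field_simps)
    finally show ?thesis
      using upper[OF that i0] K[of x] \<beta>(2)[of x] unfolding h_def by linarith
  qed
  have h_lsc: "closed {x \<in> D. h x \<le> r}" for r
  proof -
    \<comment> \<open>Membership in \<open>D\<close> is automatic on the right, since the
      inequalities themselves bound the supremum.\<close>
    have "{x \<in> D. h x \<le> r} = (\<Inter>i\<in>I. {x. f i x + c i + inner x (T x) / 2 \<le> r})" (is "?A = ?B")
    proof (intro set_eqI iffI)
      fix x assume "x \<in> ?A"
      then have "x \<in> D" "F x + inner x (T x) / 2 \<le> r" by (auto simp: h_def)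
      then show "x \<in> ?B" using upper[of x] by fastforce
    next
      fix x assume "x \<in> ?B"
      then have *: "f i x + c i \<le> r - inner x (T x) / 2" if "i \<in> I" for i using that by fastforce
      show "x \<in> ?A" using D_I[OF *] least[OF *] by (simp add: h_def)
    qed
    also have "closed \<dots>"
      by (intro closed_INT ballI closed_Collect_le continuous_intros
          bounded_linear.continuous_on[OF Tb] bounded_linear.continuous_on[OF f]) auto
    finally show ?thesis .
  qed
  have "q' \<in> D" by (rule D_I) (rule q')
  then have "D \<noteq> {}" by blast
  obtain p where p: "p \<in> D" "\<And>x. x \<in> D \<Longrightarrow> h p \<le> h x"
    by (rule strongly_convex_minimizer[of D "\<beta> / 8" h, OF \<open>D \<noteq> {}\<close> _ h_mid h_bdd h_lsc])
      (use \<beta>(1) in auto)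
  show thesis
  proof (rule that[of p "F p"])
    show "f i p + c i \<le> F p" if "i \<in> I" for i using upper p(1) that .
    fix q r assume q: "\<And>i. i \<in> I \<Longrightarrow> f i q + c i \<le> r"
    \<comment> \<open>First-order optimality: compare \<open>h p\<close> with \<open>h\<close> at a
      point of the segment towards \<open>q\<close>, divide by \<open>t\<close> and let
      \<open>t\<close> tend to 0, which removes the remainder \<open>t * k\<close>. The outcome says
      that \<open>- T p\<close> is a subgradient of \<open>F\<close> at \<open>p\<close>.\<close>
    define k where "k = inner (q - p) (T (q - p)) / 2"
    have *: "F p + inner (T p) (p - q) - r \<le> t * k" if "0 < t" "t < 1" for t
    proof -
      let ?x = "p + t *\<^sub>R (q - p)"
      have le: "f i ?x + c i \<le> (1 - t) * F p + t * r" if "i \<in> I" for i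
        using p(1) q that \<open>0 < t\<close> \<open>t < 1\<close> by (intro conv) auto
      have "h p \<le> h ?x" using D_I[OF le] by (rule p(2))
      also have "h ?x \<le> (1 - t) * F p + t * r + inner ?x (T ?x) / 2"
        using least[OF le] by (simp add: h_def)
      finally have "0 \<le> t * (r - F p + inner (T p) (q - p) + t * k)"
        unfolding quad h_def k_def power2_eq_square by argo
      then have "0 \<le> r - F p + inner (T p) (q - p) + t * k"
        using \<open>0 < t\<close> by (simp add: zero_le_mult_iff)
      then show ?thesis by (simp add: inner_diff_right)
    qed
    have "((\<lambda>t. t * k) \<longlongrightarrow> 0 * k) (at_right 0)"
      by (intro tendsto_intros)
    moreover have "\<forall>\<^sub>F t in at_right 0. F p + inner (T p) (p - q) - r \<le> t * k"
      using * by (auto simp: eventually_at_right[of 0 1, simplified] intro!: exI[of _ 1])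
    ultimately have "F p + inner (T p) (p - q) - r \<le> 0 * k"
      by (intro tendsto_lowerbound) auto
    then show "F p + inner (T p) (p - q) \<le> r" by simp
  qed
qed

section \<open>Representation of functionals and inversion of operators\<close>

lemma self_adjoint_linear_id: "self_adjoint_linear (\<lambda>x. x)"
  by (simp add: self_adjoint_linear_def linear_id[unfolded id_def])

lemma strongly_monotone_id: "strongly_monotone (\<lambda>x. x)"
  by (auto simp: strongly_monotone_def power2_norm_eq_inner intro!: exI[of _ 1])

text \<open>For the one-member family \<open>- f\<close> the subgradient inequality reads
  \<open>f d \<le> inner (T p) d\<close>; using it for both \<open>d\<close> and \<open>- d\<close>
  gives equality.\<close>

theorem Lax_Milgram_symmetric:
  fixes T :: "'a::{real_inner, complete_space} \<Rightarrow> 'a"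
  assumes T: "self_adjoint_linear T" "strongly_monotone T" and f: "bounded_linear f"
  shows "\<exists>p. \<forall>q. f q = inner (T p) q"
proof -
  obtain p s where p: "- f p \<le> s" "\<And>q r. - f q \<le> r \<Longrightarrow> s + inner (T p) (p - q) \<le> r"
    using sup_affine_plus_quadratic_minimizer[OF T, of "{()}" "\<lambda>_ q. - f q" 0 "\<lambda>_. 0" 0]
      bounded_linear_minus[OF f] linear_0[OF bounded_linear.linear[OF f]] by auto
  interpret f: bounded_linear f by (rule f)
  have *: "f d \<le> inner (T p) d" for d
    using p(1) p(2)[OF order_refl, of "p + d"] by (simp add: f.add)
  have "f q = inner (T p) q" for q using *[of q] *[of "- q"] by (simp add: f.neg)
  then show ?thesis by blast
qed

corollary Riesz_representation:
  fixes f :: "'a::{real_inner, complete_space} \<Rightarrow> real"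
  assumes "bounded_linear f"
  shows "\<exists>p. \<forall>q. f q = inner p q"
  using Lax_Milgram_symmetric[OF self_adjoint_linear_id strongly_monotone_id assms] .

text \<open>Since \<open>adjoint\<close> is a choice operator, its identity holds only after some
  adjoint is exhibited; Riesz representation supplies one pointwise.\<close>

lemma inner_adjoint:
  fixes L :: "'a::{real_inner, complete_space} \<Rightarrow> 'b::real_inner"
  assumes "bounded_linear L"
  shows "inner x (adjoint L y) = inner (L x) y"
proof -
  have "\<exists>p. \<forall>x. inner (L x) y = inner x p" for y
    using Riesz_representation[OF bounded_linear_compose[OF bounded_linear_inner_left assms], of y]
    by (simp add: inner_commute)
  then obtain f' where "\<And>x y. inner (L x) y = inner x (f' y)" by metis
  then have "\<exists>f'. \<forall>x y. inner (L x) y = inner x (f' y)" by blast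
  then have "\<forall>x y. inner (L x) y = inner x (adjoint L y)"
    unfolding adjoint_def by (rule someI_ex)
  then show ?thesis by simp
qed

lemma strongly_monotone_bij:
  fixes T :: "'a::{real_inner, complete_space} \<Rightarrow> 'a"
  assumes T: "self_adjoint_linear T" "strongly_monotone T"
  shows "bij T"
proof (rule bijI)
  note lin = self_adjoint_linearD(1)[OF T(1)]
  obtain \<beta> where \<beta>: "\<beta> > 0" "\<And>x. \<beta> * (norm x)\<^sup>2 \<le> inner x (T x)"
    using T(2) by (rule strongly_monotoneE) blast
  show "inj T"
  proof (rule linear_injective_0[OF lin, THEN iffD2], intro allI impI)
    fix x assume "T x = 0"
    then show "x = 0" using \<beta>(1) \<beta>(2)[of x] by (simp add: mult_le_0_iff)
  qed
  have "\<exists>x. T x = b" for b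
  proof -
    obtain p where "\<And>q. inner b q = inner (T p) q"
      using Lax_Milgram_symmetric[OF T bounded_linear_inner_right] by blast
    then have "T p = b" by (metis vector_eq_rdot)
    then show "\<exists>x. T x = b" ..
  qed
  then show "surj T" by (metis surj_def)
qed

lemma self_adjoint_linear_inv:
  fixes T :: "'a::{real_inner, complete_space} \<Rightarrow> 'a"
  assumes T: "self_adjoint_linear T" "strongly_monotone T"
  shows "self_adjoint_linear (inv T)"
proof -
  have *: "T (inv T x) = x" "inv T (T x) = x" for x
    using strongly_monotone_bij[OF T] by (simp_all add: bij_def surj_f_inv_f inv_f_f)
  note lin = self_adjoint_linearD(1)[OF T(1)] and sym = self_adjoint_linearD(2)[OF T(1)]
  have "linear (inv T)"
    by (rule linearI) (metis * linear_add[OF lin], metis * linear_cmul[OF lin])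
  moreover have "inner (inv T x) y = inner x (inv T y)" for x y
    using sym[of "inv T x" "inv T y"] by (simp add: *)
  ultimately show ?thesis by (simp add: self_adjoint_linear_def)
qed

lemma strongly_monotone_inv:
  fixes T :: "'a::{real_inner, complete_space} \<Rightarrow> 'a"
  assumes T: "self_adjoint_linear T" "strongly_monotone T"
  shows "strongly_monotone (inv T)"
proof -
  have *: "T (inv T x) = x" for x
    using strongly_monotone_bij[OF T] by (simp add: bij_def surj_f_inv_f)
  obtain \<beta> where \<beta>: "\<beta> > 0" "\<And>x. \<beta> * (norm x)\<^sup>2 \<le> inner x (T x)"
    using T(2) by (rule strongly_monotoneE) blast
  obtain K where K: "K > 0" "\<And>x. norm (T x) \<le> norm x * K"
    using bounded_linear.pos_bounded[OF Hellinger_Toeplitz[OF T(1)]] by blast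
  \<comment> \<open>Strong monotonicity of \<open>T\<close> at \<open>inv T y\<close>, together with
    \<open>norm y \<le> K * norm (inv T y)\<close>, produces the constant.\<close>
  have "\<beta> / K\<^sup>2 * (norm y)\<^sup>2 \<le> inner y (inv T y)" for y
  proof -
    have "(norm y)\<^sup>2 \<le> (norm (inv T y) * K)\<^sup>2"
      using K(2)[of "inv T y"] by (intro power_mono) (auto simp: *)
    then have "(norm y)\<^sup>2 / K\<^sup>2 \<le> (norm (inv T y))\<^sup>2"
      using K(1) by (simp add: power_mult_distrib divide_le_eq)
    then have "\<beta> * ((norm y)\<^sup>2 / K\<^sup>2) \<le> \<beta> * (norm (inv T y))\<^sup>2"
      using \<beta>(1) by (intro mult_left_mono) auto
    also have "\<dots> \<le> inner y (inv T y)"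
      using \<beta>(2)[of "inv T y"] by (simp add: * inner_commute)
    finally show ?thesis by simp
  qed
  then show ?thesis
    unfolding strongly_monotone_def using \<beta>(1) K(1) by (intro exI[of _ "\<beta> / K\<^sup>2"]) auto
qed

section \<open>Block-diagonal operators on the direct sum\<close>

lemma self_adjoint_linear_Pair:
  assumes "self_adjoint_linear S" "self_adjoint_linear T"
  shows "self_adjoint_linear (\<lambda>p. (S (fst p), T (snd p)))"
proof -
  have "linear (\<lambda>p. (S (fst p), T (snd p)))"
    using self_adjoint_linearD(1)[OF assms(1)] self_adjoint_linearD(1)[OF assms(2)]
    by (intro linearI) (auto simp: linear_add linear_cmul)
  then show ?thesis
    using assms by (simp add: self_adjoint_linear_def inner_prod_def)
qed

lemma strongly_monotone_Pair:
  assumes "strongly_monotone S" "strongly_monotone T"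
  shows "strongly_monotone (\<lambda>p. (S (fst p), T (snd p)))"
proof -
  obtain a b where ab: "a > 0" "\<And>x. a * (norm x)\<^sup>2 \<le> inner x (S x)"
    "b > 0" "\<And>x. b * (norm x)\<^sup>2 \<le> inner x (T x)"
    using assms by (meson strongly_monotoneE)
  have "min a b * (norm p)\<^sup>2 \<le> inner p (S (fst p), T (snd p))" for p
  proof -
    have "min a b * (norm p)\<^sup>2 = min a b * (norm (fst p))\<^sup>2 + min a b * (norm (snd p))\<^sup>2"
      by (simp add: norm_prod_def algebra_simps)
    also have "\<dots> \<le> a * (norm (fst p))\<^sup>2 + b * (norm (snd p))\<^sup>2"
      by (intro add_mono mult_right_mono) auto
    also have "\<dots> \<le> inner p (S (fst p), T (snd p))"
      using ab(2)[of "fst p"] ab(4)[of "snd p"] by (simp add: inner_prod_def)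
    finally show ?thesis .
  qed
  then show ?thesis
    unfolding strongly_monotone_def using ab(1,3) by (intro exI[of _ "min a b"]) auto
qed

section \<open>Maximally monotone operators and resolvents\<close>

text \<open>Adjoining the pair \<open>(x, w)\<close> to the graph keeps it monotone, so maximality
  forces the pair to be there already.\<close>

lemma maximally_monotone_memI:
  assumes "maximally_monotone A" and rel: "\<And>y a. a \<in> A y \<Longrightarrow> 0 \<le> inner (x - y) (w - a)"
  shows "w \<in> A x"
proof -
  define N where "N = A(x := insert w (A x))"
  have "monotone_operator N"
    unfolding monotone_operator_def
  proof (intro allI ballI)
    fix y y' a a' assume "a \<in> N y" "a' \<in> N y'"
    moreover have "0 \<le> inner (y - y') (a - a')" if "a \<in> A y" "a' \<in> A y'"
      using assms(1) that by (auto simp: maximally_monotone_def monotone_operator_def)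
    moreover have "inner (y - x) (a - w) = inner (x - y) (w - a)"
      by (simp add: inner_diff_left inner_diff_right)
    ultimately show "0 \<le> inner (y - y') (a - a')"
      using rel[of a y] rel[of a' y'] unfolding N_def by (auto split: if_splits)
  qed
  moreover have "A y \<subseteq> N y" for y by (auto simp: N_def)
  ultimately have "N = A" using assms(1) by (auto simp: maximally_monotone_def)
  then show ?thesis by (metis N_def fun_upd_same insertI1)
qed

lemma maximally_monotoneD:
  assumes "maximally_monotone A" "a \<in> A x" "b \<in> A y"
  shows "0 \<le> inner (x - y) (a - b)"
  using assms by (auto simp: maximally_monotone_def monotone_operator_def)

text \<open>The Fitzpatrick function plus half the form of \<open>S\<close> and \<open>T\<close> on
  pairs has a minimizer \<open>(x, w)\<close>. Its optimality condition, tested on the graph, places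
  \<open>(- T w, - S x)\<close> in the graph and then forces \<open>w = - S x\<close>.\<close>

lemma Minty_weighted:
  fixes A :: "'a::{real_inner, complete_space} \<Rightarrow> 'a set"
  assumes A: "maximally_monotone A" and T: "self_adjoint_linear T" "strongly_monotone T"
  obtains p a where "a \<in> A p" "z = p + T a"
proof -
  define S where "S = inv T"
  have ST: "T (S x) = x" for x
    using strongly_monotone_bij[OF T] by (simp add: S_def bij_def surj_f_inv_f)
  note S = self_adjoint_linear_inv[OF T, folded S_def] strongly_monotone_inv[OF T, folded S_def]
  note lin = self_adjoint_linearD(1)[OF T(1)] and sym = self_adjoint_linearD(2)[OF T(1)]
  obtain \<beta> where \<beta>: "\<beta> > 0" "\<And>x. \<beta> * (norm x)\<^sup>2 \<le> inner x (T x)"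
    using T(2) by (rule strongly_monotoneE) blast
  \<comment> \<open>After this translation the goal is a pair \<open>(y, a)\<close> in
    \<open>G\<close> with \<open>y + T a = 0\<close>.\<close>
  define G where "G = {(y, a). a \<in> A (z + y)}"
  have mono: "0 \<le> inner (y - y') (a - a')" if "(y, a) \<in> G" "(y', a') \<in> G" for y y' a a'
    using maximally_monotoneD[OF A, of a "z + y" a' "z + y'"] that by (simp add: G_def)
  have maxi: "(x, w) \<in> G" if "\<And>y a. (y, a) \<in> G \<Longrightarrow> 0 \<le> inner (x - y) (w - a)" for x w
    unfolding G_def using that[of "_ - z"]
    by (auto simp: G_def algebra_simps intro!: maximally_monotone_memI[OF A])
  \<comment> \<open>Were \<open>G\<close> empty, the premise of \<open>maxi\<close> would hold
    vacuously and put every pair into \<open>G\<close>.\<close>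
  have "G \<noteq> {}" using maxi by force
  then obtain y0 a0 where ya0: "(y0, a0) \<in> G" by auto
  \<comment> \<open>The supremum over \<open>G\<close> of these affine functions is the Fitzpatrick function of \<open>G\<close>.\<close>
  define f where "f = (\<lambda>(y, a) (q :: 'a \<times> 'a). inner (fst q) a + inner (snd q) y)"
  define c where "c = (\<lambda>(y :: 'a, a). - inner y a)"
  have on_G: "f i q + c i \<le> inner (fst q) (snd q)" if "i \<in> G" "q \<in> G" for i q
    using mono[of "fst q" "snd q" "fst i" "snd i"] that
    by (cases i; cases q) (auto simp: f_def c_def inner_diff_left inner_diff_right inner_commute)
  have f_lin: "bounded_linear (f i)" for i
    unfolding f_def case_prod_beta
    by (intro bounded_linear_add bounded_linear_compose[OF bounded_linear_inner_left]
        bounded_linear_fst bounded_linear_snd)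
  have on_G': "f i (y0, a0) + c i \<le> inner y0 a0" if "i \<in> G" for i
    using on_G[OF that ya0] by simp
  obtain p s where ps: "\<And>i. i \<in> G \<Longrightarrow> f i p + c i \<le> s"
    "\<And>q r. (\<And>i. i \<in> G \<Longrightarrow> f i q + c i \<le> r) \<Longrightarrow> s + inner (S (fst p), T (snd p)) (p - q) \<le> r"
    using sup_affine_plus_quadratic_minimizer[where f = f and c = c, OF
        self_adjoint_linear_Pair[OF S(1) T(1)] strongly_monotone_Pair[OF S(2) T(2)]
        \<open>G \<noteq> {}\<close> f_lin on_G'] by blast
  define x w where "x = fst p" and "w = snd p"
  \<comment> \<open>The Fitzpatrick function dominates the duality product: outside
    \<open>G\<close>, maximality gives a pair of \<open>G\<close> that violates monotonicity, and
    its affine function exceeds \<open>inner x w\<close>.\<close>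
  have "inner x w \<le> s"
  proof (cases "(x, w) \<in> G")
    case True
    then show ?thesis using ps(1)[OF True] by (simp add: f_def c_def x_def w_def inner_commute case_prod_beta)
  next
    case False
    then obtain y a where ya: "(y, a) \<in> G" "inner (x - y) (w - a) < 0"
      using maxi[of x w] by (meson not_le)
    then show ?thesis using ps(1)[OF ya(1)]
      by (simp add: f_def c_def x_def w_def inner_diff_left inner_diff_right inner_commute)
  qed
  \<comment> \<open>On \<open>G\<close> the Fitzpatrick function is at most
    \<open>inner y a\<close>, so the subgradient inequality applies with this bound; replacing
    \<open>s\<close> by \<open>inner x w\<close> completes the square in the
    \<open>T\<close>-form.\<close>
  have key: "inner (S x + w) (T (S x + w)) \<le> inner (y - (- T w)) (a - (- S x))" if "(y, a) \<in> G" for y a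
  proof -
    have "s + inner (S x, T w) (p - (y, a)) \<le> inner y a"
      using ps(2)[OF on_G[OF _ that]] by (simp add: x_def w_def)
    then have "s + inner (S x) x - inner (S x) y + inner (T w) w - inner (T w) a \<le> inner y a"
      by (simp add: inner_prod_def inner_diff_right x_def w_def algebra_simps)
    moreover have "inner (T w) (S x) = inner x w"
      unfolding sym ST by (rule inner_commute)
    moreover have "inner (S x + w) (T (S x + w)) = inner (S x) x + 2 * inner x w + inner (T w) w"
      using calculation(2)
      by (simp add: linear_add[OF lin] ST inner_add_left inner_add_right inner_commute)
    moreover have "inner (y - (- T w)) (a - (- S x)) =
        inner y a + inner (S x) y + inner (T w) a + inner (T w) (S x)"
      by (simp add: inner_add_left inner_add_right inner_commute)
    ultimately show ?thesis
      using \<open>inner x w \<le> s\<close> by linarith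
  qed
  have "(- T w, - S x) \<in> G"
  proof (rule maxi)
    fix y a assume "(y, a) \<in> G"
    have "0 \<le> inner (S x + w) (T (S x + w))"
      using \<beta>(1) \<beta>(2)[of "S x + w"] by (meson less_imp_le mult_nonneg_nonneg order_trans zero_le_power2)
    also note key[OF \<open>(y, a) \<in> G\<close>]
    finally show "0 \<le> inner (- T w - y) (- S x - a)"
      by (simp add: inner_diff_left inner_diff_right inner_add_left inner_add_right)
  qed
  \<comment> \<open>At the point of \<open>G\<close> just found the right side of \<open>key\<close>
    vanishes.\<close>
  moreover have "\<beta> * (norm (S x + w))\<^sup>2 \<le> 0"
    using key[OF calculation] \<beta>(2)[of "S x + w"] by simp
  then have "w = - S x"
    using \<beta>(1) by (simp add: mult_le_0_iff add_eq_0_iff)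
  ultimately have "- S x \<in> A (z + x)"
    by (simp add: G_def linear_neg[OF lin] ST)
  moreover have "z = (z + x) + T (- S x)" by (simp add: linear_neg[OF lin] ST)
  ultimately show thesis by (rule that)
qed

text \<open>\<open>the_elem\<close> is meaningful only on a singleton. Existence is Minty's theorem;
  two solutions satisfy \<open>q - p = T (a - b)\<close>, and monotonicity of \<open>A\<close> then
  contradicts that of \<open>T\<close> unless \<open>a = b\<close>.\<close>

lemma resolvent_mem:
  fixes A :: "'a::{real_inner, complete_space} \<Rightarrow> 'a set"
  assumes A: "maximally_monotone A" and T: "self_adjoint_linear T" "strongly_monotone T"
  shows "inv T (z - resolvent (\<lambda>y. T ` A y) z) \<in> A (resolvent (\<lambda>y. T ` A y) z)"
proof -
  obtain p a where pa: "a \<in> A p" "z = p + T a"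
    by (rule Minty_weighted[OF A T])
  note lin = self_adjoint_linearD(1)[OF T(1)]
  obtain \<beta> where \<beta>: "\<beta> > 0" "\<And>x. \<beta> * (norm x)\<^sup>2 \<le> inner x (T x)"
    using T(2) by (rule strongly_monotoneE) blast
  have "q = p" if "b \<in> A q" "z = q + T b" for q b
  proof -
    have qp: "q - p = T (a - b)" using pa(2) that(2) by (simp add: linear_diff[OF lin] algebra_simps)
    have "0 \<le> inner (q - p) (b - a)" using maximally_monotoneD[OF A that(1) pa(1)] .
    also have "\<dots> = - inner (a - b) (T (a - b))"
      unfolding qp by (metis inner_commute inner_minus_right minus_diff_eq)
    finally have "\<beta> * (norm (a - b))\<^sup>2 \<le> 0" using \<beta>(2)[of "a - b"] by linarith
    then have "a = b" using \<beta>(1) by (simp add: mult_le_0_iff)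
    then show ?thesis using qp by (simp add: linear_0[OF lin])
  qed
  then have "op_inverse (\<lambda>x. {x + y |y. y \<in> T ` A x}) z = {p}"
    using pa by (auto simp: op_inverse_def)
  then have "resolvent (\<lambda>y. T ` A y) z = p" by (simp add: resolvent_def)
  moreover have "inv T (z - p) = a"
    using pa(2) strongly_monotone_bij[OF T] by (simp add: bij_def inv_f_f)
  ultimately show ?thesis using pa(1) by simp
qed

section \<open>Weak cluster points and Fejer monotone sequences\<close>

text \<open>Hilbert spaces need not be separable, so weak cluster points are taken along filters; this
  reduces weak compactness to Tychonoff's theorem and costs nothing in the Opial argument.\<close>

lemma bounded_weak_cluster_point:
  fixes s :: "'i \<Rightarrow> 'a::{real_inner, complete_space}"
  assumes "F \<noteq> bot" and bound: "\<And>i. norm (s i) \<le> K"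
  obtains G l where "G \<le> F" "G \<noteq> bot" "\<And>y. ((\<lambda>i. inner (s i) y) \<longlongrightarrow> inner l y) G"
proof -
  define f where "f i = (\<lambda>y. inner (s i) y)" for i
  \<comment> \<open>By Cauchy-Schwarz the functionals \<open>f i\<close> lie in this product of
    compact intervals, where the product topology is pointwise convergence.\<close>
  define U where "U = (\<Pi>\<^sub>E y\<in>(UNIV::'a set). {- (K * norm y)..K * norm y})"
  have "compactin (product_topology (\<lambda>_::'a. euclideanreal) UNIV) U"
    unfolding U_def compactin_PiE by simp
  then have "compact U" by (simp add: euclidean_product_topology)
  moreover have "filtermap f F \<noteq> bot" using assms(1) by (simp add: filtermap_bot_iff)
  moreover have "f i \<in> U" for i
  proof -
    have "\<bar>inner (s i) y\<bar> \<le> K * norm y" for y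
      using Cauchy_Schwarz_ineq2[of "s i" y] mult_right_mono[OF bound[of i] norm_ge_zero[of y]] by linarith
    then show ?thesis by (auto simp: U_def f_def PiE_def abs_le_iff minus_le_iff)
  qed
  ultimately obtain \<phi> where \<phi>: "\<phi> \<in> U" "inf (nhds \<phi>) (filtermap f F) \<noteq> bot"
    unfolding compact_filter by (metis (mono_tags, lifting) always_eventually eventually_filtermap)
  define G where "G = inf (filtercomap f (nhds \<phi>)) F"
  have "G \<noteq> bot"
  proof
    assume "G = bot"
    then obtain P Q where "eventually P (nhds \<phi>)" "eventually Q F" "\<And>i. P (f i) \<Longrightarrow> Q i \<Longrightarrow> False"
      unfolding G_def trivial_limit_def eventually_inf eventually_filtercomap by blast
    then have "eventually P (nhds \<phi>)" "eventually (\<lambda>g. \<not> P g) (filtermap f F)"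
      by (auto simp: eventually_filtermap elim!: eventually_mono)
    then have "eventually (\<lambda>_. False) (inf (nhds \<phi>) (filtermap f F))"
      unfolding eventually_inf by blast
    with \<phi>(2) show False by (simp add: trivial_limit_def)
  qed
  have "(f \<longlongrightarrow> \<phi>) G"
    unfolding G_def by (meson filterlim_filtercomap filterlim_mono inf_le1 order_refl)
  then have lim: "((\<lambda>i. inner (s i) y) \<longlongrightarrow> \<phi> y) G" for y
    using continuous_on_tendsto_compose[OF continuous_on_product_coordinates[of y]]
    unfolding f_def by fastforce
  \<comment> \<open>Linearity passes to pointwise limits, and membership in \<open>U\<close> is the
    bound \<open>K\<close>; Riesz representation then turns \<open>\<phi>\<close> into a
    vector.\<close>
  have "bounded_linear \<phi>"
  proof (rule bounded_linear_intro[where K = K])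
    fix y y' :: 'a and c :: real
    show "\<phi> (y + y') = \<phi> y + \<phi> y'"
      using tendsto_unique[OF \<open>G \<noteq> bot\<close> lim[of "y + y'"]] tendsto_add[OF lim[of y] lim[of y']]
      by (simp add: inner_add_right)
    show "\<phi> (c *\<^sub>R y) = c *\<^sub>R \<phi> y"
      using tendsto_unique[OF \<open>G \<noteq> bot\<close> lim[of "c *\<^sub>R y"]] tendsto_mult_left[OF lim[of y], of c]
      by simp
    show "norm (\<phi> y) \<le> norm y * K"
    proof -
      have "\<phi> y \<in> {- (K * norm y)..K * norm y}" using \<phi>(1) unfolding U_def by (rule PiE_mem) simp
      then show ?thesis by (simp add: abs_le_iff mult.commute minus_le_iff)
    qed
  qed
  then obtain l where "\<And>y. \<phi> y = inner l y" using Riesz_representation by blast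
  then show thesis using that[of G l] \<open>G \<noteq> bot\<close> lim by (simp add: G_def)
qed

lemma fejer_bounded:
  fixes P :: "'a::{real_inner, complete_space} \<Rightarrow> 'a"
  assumes P: "strongly_monotone P"
    and dec: "\<And>n. inner (X (Suc n) - \<zeta>) (P (X (Suc n) - \<zeta>)) \<le> inner (X n - \<zeta>) (P (X n - \<zeta>))"
  obtains K where "\<And>n. norm (X n) \<le> K"
proof -
  obtain \<beta> where \<beta>: "\<beta> > 0" "\<And>x. \<beta> * (norm x)\<^sup>2 \<le> inner x (P x)"
    using P by (rule strongly_monotoneE) blast
  define C where "C = inner (X 0 - \<zeta>) (P (X 0 - \<zeta>))"
  have "inner (X n - \<zeta>) (P (X n - \<zeta>)) \<le> C" for n
    by (induction n) (use dec in \<open>auto simp: C_def intro: order_trans\<close>)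
  then have "\<beta> * (norm (X n - \<zeta>))\<^sup>2 \<le> C" for n using \<beta>(2) order_trans by blast
  then have "(norm (X n - \<zeta>))\<^sup>2 \<le> C / \<beta>" for n using \<beta>(1) by (simp add: field_simps)
  then have "norm (X n - \<zeta>) \<le> sqrt (C / \<beta>)" for n by (simp add: real_le_rsqrt)
  then have "norm (X n) \<le> norm \<zeta> + sqrt (C / \<beta>)" for n
    using norm_triangle_sub[of "X n" \<zeta>] by (smt (verit))
  then show thesis by (rule that)
qed

text \<open>For two cluster points the difference of the \<open>P\<close>-distances from
  \<open>X n\<close> is affine in \<open>X n\<close>, with linear part a multiple of
  \<open>inner (X n) (P ?d)\<close>. Both distances converge, so this functional has a single limit
  and cannot separate the two points.\<close>

lemma fejer_Opial:
  fixes P :: "'a::{real_inner, complete_space} \<Rightarrow> 'a" and X :: "nat \<Rightarrow> 'a"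
  assumes P: "self_adjoint_linear P" "strongly_monotone P" and "Z \<noteq> {}"
    and dec: "\<And>n \<zeta>. \<zeta> \<in> Z \<Longrightarrow>
      inner (X (Suc n) - \<zeta>) (P (X (Suc n) - \<zeta>)) \<le> inner (X n - \<zeta>) (P (X n - \<zeta>))"
    and cluster: "\<And>F \<zeta>. F \<le> sequentially \<Longrightarrow> F \<noteq> bot \<Longrightarrow>
      (\<And>y. ((\<lambda>n. inner (X n) y) \<longlongrightarrow> inner \<zeta> y) F) \<Longrightarrow> \<zeta> \<in> Z"
  shows "\<exists>\<zeta>\<in>Z. weakly_converges X \<zeta>"
proof -
  note lin = self_adjoint_linearD(1)[OF P(1)] and sym = self_adjoint_linearD(2)[OF P(1)]
  obtain \<beta> where \<beta>: "\<beta> > 0" "\<And>x. \<beta> * (norm x)\<^sup>2 \<le> inner x (P x)"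
    using P(2) by (rule strongly_monotoneE) blast
  obtain K where K: "\<And>n. norm (X n) \<le> K"
    using \<open>Z \<noteq> {}\<close> fejer_bounded[where X = X, OF P(2) dec] by blast
  have conv: "convergent (\<lambda>n. inner (X n - \<zeta>) (P (X n - \<zeta>)))" if "\<zeta> \<in> Z" for \<zeta>
  proof -
    have "0 \<le> inner x (P x)" for x
      using \<beta>(1) \<beta>(2)[of x] by (meson less_imp_le mult_nonneg_nonneg order_trans zero_le_power2)
    moreover have "decseq (\<lambda>n. inner (X n - \<zeta>) (P (X n - \<zeta>)))"
      using dec[OF that] by (rule decseq_SucI)
    ultimately obtain l where "(\<lambda>n. inner (X n - \<zeta>) (P (X n - \<zeta>))) \<longlonglongrightarrow> l"
      using decseq_convergent[of "\<lambda>n. inner (X n - \<zeta>) (P (X n - \<zeta>))" 0] by blast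
    then show ?thesis by (rule convergentI)
  qed
  have unique: "\<zeta>\<^sub>1 = \<zeta>\<^sub>2"
    if F1: "F\<^sub>1 \<le> sequentially" "F\<^sub>1 \<noteq> bot" "\<And>y. ((\<lambda>n. inner (X n) y) \<longlongrightarrow> inner \<zeta>\<^sub>1 y) F\<^sub>1"
    and F2: "F\<^sub>2 \<le> sequentially" "F\<^sub>2 \<noteq> bot" "\<And>y. ((\<lambda>n. inner (X n) y) \<longlongrightarrow> inner \<zeta>\<^sub>2 y) F\<^sub>2"
    for \<zeta>\<^sub>1 \<zeta>\<^sub>2 F\<^sub>1 F\<^sub>2
  proof -
    let ?d = "\<zeta>\<^sub>1 - \<zeta>\<^sub>2"
    have "inner (X n) (P ?d) =
      (inner \<zeta>\<^sub>1 (P \<zeta>\<^sub>1) - inner \<zeta>\<^sub>2 (P \<zeta>\<^sub>2) - (inner (X n - \<zeta>\<^sub>1) (P (X n - \<zeta>\<^sub>1)) - inner (X n - \<zeta>\<^sub>2) (P (X n - \<zeta>\<^sub>2)))) / 2"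
      for n
      using sym[of "X n" \<zeta>\<^sub>1] sym[of "X n" \<zeta>\<^sub>2]
      by (simp add: linear_diff[OF lin] inner_diff_left inner_diff_right inner_commute)
    then have eq: "(\<lambda>n. inner (X n) (P ?d)) = (\<lambda>n. (inner \<zeta>\<^sub>1 (P \<zeta>\<^sub>1) - inner \<zeta>\<^sub>2 (P \<zeta>\<^sub>2) -
        (inner (X n - \<zeta>\<^sub>1) (P (X n - \<zeta>\<^sub>1)) - inner (X n - \<zeta>\<^sub>2) (P (X n - \<zeta>\<^sub>2)))) / 2)"
      by (rule ext)
    have "convergent (\<lambda>n. inner (X n) (P ?d))"
      unfolding eq using conv[OF cluster[OF F1]] conv[OF cluster[OF F2]]
      unfolding convergent_def
      by (elim exE) (rule exI, (assumption | rule tendsto_intros | simp)+)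
    then obtain l where l: "(\<lambda>n. inner (X n) (P ?d)) \<longlonglongrightarrow> l" unfolding convergent_def by blast
    have "inner \<zeta>\<^sub>1 (P ?d) = l"
      using tendsto_unique[OF F1(2) F1(3)] tendsto_mono[OF F1(1) l] by blast
    moreover have "inner \<zeta>\<^sub>2 (P ?d) = l"
      using tendsto_unique[OF F2(2) F2(3)] tendsto_mono[OF F2(1) l] by blast
    ultimately have "\<beta> * (norm ?d)\<^sup>2 \<le> 0"
      using \<beta>(2)[of ?d] by (simp add: inner_diff_left)
    then show ?thesis using \<beta>(1) by (simp add: mult_le_0_iff)
  qed
  obtain F \<zeta> where F: "F \<le> sequentially" "F \<noteq> bot" "\<And>y. ((\<lambda>n. inner (X n) y) \<longlongrightarrow> inner \<zeta> y) F"
    by (rule bounded_weak_cluster_point[of sequentially X K]) (use K in auto)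
  have "(\<lambda>n. inner (X n) y) \<longlonglongrightarrow> inner \<zeta> y" for y
  proof (rule ccontr)
    assume "\<not> ?thesis"
    then obtain e where e: "e > 0" "\<not> (\<forall>\<^sub>F n in sequentially. dist (inner (X n) y) (inner \<zeta> y) < e)"
      unfolding tendsto_iff by blast
    \<comment> \<open>Restricting to the indices where the functional stays \<open>e\<close> away
      gives a proper filter with a cluster point of its own, which by uniqueness is
      \<open>\<zeta>\<close> again.\<close>
    define E where "E = inf sequentially (principal {n. e \<le> dist (inner (X n) y) (inner \<zeta> y)})"
    have "E \<noteq> bot"
      using e(2) by (simp add: E_def trivial_limit_def eventually_inf_principal not_le)
    then obtain G \<eta> where G: "G \<le> E" "G \<noteq> bot" "\<And>y. ((\<lambda>n. inner (X n) y) \<longlongrightarrow> inner \<eta> y) G"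
      by (rule bounded_weak_cluster_point[of E X K]) (use K in auto)
    have "G \<le> sequentially" using G(1) by (simp add: E_def)
    then have "\<eta> = \<zeta>" by (rule unique[OF _ G(2,3) F])
    then have "\<forall>\<^sub>F n in G. dist (inner (X n) y) (inner \<zeta> y) < e"
      using G(3)[of y] e(1) by (simp add: tendsto_iff)
    moreover have "\<forall>\<^sub>F n in E. e \<le> dist (inner (X n) y) (inner \<zeta> y)"
      by (simp add: E_def eventually_inf_principal)
    then have "\<forall>\<^sub>F n in G. e \<le> dist (inner (X n) y) (inner \<zeta> y)"
      using G(1) by (rule filter_leD[rotated])
    ultimately have "\<forall>\<^sub>F n in G. False" by eventually_elim simp
    then show False using G(2) by (simp add: trivial_limit_def)
  qed
  then show ?thesis using cluster[OF F] by (auto simp: weakly_converges_def)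
qed

section \<open>The split Douglas-Rachford iteration\<close>

lemma primal_dual_solutions_iff:
  "(x, u) \<in> primal_dual_solutions A B L \<longleftrightarrow> - adjoint L u \<in> A x \<and> u \<in> B (L x)"
  by (auto simp: primal_dual_solutions_def op_inverse_def add_eq_0_iff intro!: exI[of _ "- adjoint L u"])

lemma tendsto_inner_bounded_zero:
  fixes f g :: "'i \<Rightarrow> 'a::real_inner"
  assumes "\<And>n. norm (f n) \<le> K" "(g \<longlongrightarrow> 0) F"
  shows "((\<lambda>n. inner (f n) (g n)) \<longlongrightarrow> 0) F"
proof (rule Lim_null_comparison)
  show "\<forall>\<^sub>F n in F. norm (inner (f n) (g n)) \<le> K * norm (g n)"
    using order_trans[OF Cauchy_Schwarz_ineq2 mult_right_mono[OF assms(1) norm_ge_zero]]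
    by (intro always_eventually allI) simp
  show "((\<lambda>n. K * norm (g n)) \<longlongrightarrow> 0) F"
    using tendsto_mult_left[OF tendsto_norm[OF assms(2)], of K] by simp
qed

lemma summable_norm_square_tendsto_zero:
  fixes g :: "nat \<Rightarrow> 'a::real_normed_vector"
  assumes "summable (\<lambda>n. (norm (g n))\<^sup>2)"
  shows "g \<longlonglongrightarrow> 0"
  using tendsto_real_sqrt[OF summable_LIMSEQ_zero[OF assms]] by (simp add: tendsto_norm_zero_iff)

lemma summable_on_of_summable_nonneg:
  fixes f :: "nat \<Rightarrow> real"
  assumes "summable f" "\<And>n. 0 \<le> f n"
  shows "f summable_on N"
proof -
  have "f summable_on UNIV"
    using assms by (subst summable_on_UNIV_nonneg_real_iff) auto
  then show ?thesis by (rule summable_on_subset_banach) simp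
qed

text \<open>Resolvent-free form of the iteration: \<open>S\<close> and \<open>T\<close> stand for
  the inverses of \<Upsilon> and \<Sigma>, the resolvent steps become the inclusions
  \<open>in_A\<close> and \<open>in_B\<close>, and \<open>U\<close> is monotonicity written as
  nonnegativity of a quadratic form.\<close>

locale split_douglas_rachford =
  fixes A :: "'a::{real_inner, complete_space} \<Rightarrow> 'a set"
    and B :: "'b::{real_inner, complete_space} \<Rightarrow> 'b set"
    and L :: "'a \<Rightarrow> 'b" and \<Sigma> T :: "'b \<Rightarrow> 'b" and S :: "'a \<Rightarrow> 'a"
    and x :: "nat \<Rightarrow> 'a" and u v :: "nat \<Rightarrow> 'b"
  assumes A: "maximally_monotone A" and B: "maximally_monotone B" and L: "bounded_linear L"
    and S: "self_adjoint_linear S" "strongly_monotone S"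
    and T: "self_adjoint_linear T" "strongly_monotone T"
    and Sigma: "self_adjoint_linear \<Sigma>" and T_Sigma: "T (\<Sigma> y) = y"
    and U: "inner (L p) (\<Sigma> (L p)) \<le> inner p (S p)"
    and in_A: "S (x n - x (Suc n)) - adjoint L (v n) \<in> A (x (Suc n))"
    and in_B: "v n \<in> B (L (x (Suc n)) + T (u n - u (Suc n)))"
    and u_Suc: "u (Suc n) = \<Sigma> (L (x (Suc n) - x n)) + v n"
begin

definition "d n = x (Suc n) - x n"
definition "e n = u (Suc n) - u n"
definition "w n = v n - u n"
definition "P p = (S (fst p), T (snd p))"
definition "X n = (x n, u n)"
text \<open>The quadratic form of the possibly degenerate operator \<open>U\<close> of the
  theorem.\<close>

definition "Q p = inner p (S p) - inner (L p) (\<Sigma> (L p))"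
definition "\<delta> n = Q (d n) + inner (w n) (T (w n))"

lemmas lins = self_adjoint_linearD(1)[OF S(1)] self_adjoint_linearD(1)[OF T(1)]
  self_adjoint_linearD(1)[OF Sigma] bounded_linear.linear[OF L]
lemmas lin_simps = lins[THEN linear_add] lins[THEN linear_diff] lins[THEN linear_neg]
lemmas adj = inner_adjoint[OF L]

lemma adj': "inner (adjoint L q) p = inner q (L p)"
  using adj[of p q] by (simp add: inner_commute)

lemma symS: "inner p (S q) = inner q (S p)"
  by (subst inner_commute) (rule self_adjoint_linearD(2)[OF S(1)])

lemma symT: "inner p (T q) = inner q (T p)"
  by (subst inner_commute) (rule self_adjoint_linearD(2)[OF T(1)])

lemma symSigma: "inner p (\<Sigma> q) = inner q (\<Sigma> p)"
  by (subst inner_commute) (rule self_adjoint_linearD(2)[OF Sigma])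

lemma T_Sigma_inner: "inner (\<Sigma> p) (T q) = inner p q"
  using symT[of "\<Sigma> p" q] by (simp add: T_Sigma inner_commute)

lemma Q_nonneg: "0 \<le> Q p"
  using U[of p] by (simp add: Q_def)

lemma T_nonneg: "0 \<le> inner p (T p)"
proof -
  obtain \<tau> where "\<tau> > 0" "\<tau> * (norm p)\<^sup>2 \<le> inner p (T p)"
    using strongly_monotoneE[OF T(2)] by blast
  then show ?thesis by (meson less_imp_le mult_nonneg_nonneg order_trans zero_le_power2)
qed

lemma \<delta>_nonneg: "0 \<le> \<delta> n"
  by (simp add: \<delta>_def Q_nonneg T_nonneg)

lemma e_eq: "e n = \<Sigma> (L (d n)) + w n"
  by (simp add: e_def w_def d_def u_Suc)

lemma in_A': "- S (d n) - adjoint L (v n) \<in> A (x (Suc n))"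
  using in_A[of n] by (simp add: d_def lin_simps)

lemma in_B': "v n \<in> B (L (x (Suc n)) - T (e n))"
  using in_B[of n] by (simp add: e_def lin_simps algebra_simps)

text \<open>Adding the monotonicity inequalities of \<open>A\<close> and \<open>B\<close> cancels
  the coupling \<open>inner (L a) (v n - q)\<close> and leaves a bound on
  \<open>inner a (S (d n)) + inner b (T (e n))\<close>, the cross terms in the expansion of the old
  distance about the new one.\<close>

lemma fejer:
  assumes "\<zeta> \<in> primal_dual_solutions A B L"
  shows "inner (X (Suc n) - \<zeta>) (P (X (Suc n) - \<zeta>)) + \<delta> n \<le> inner (X n - \<zeta>) (P (X n - \<zeta>))"
proof -
  obtain p q where \<zeta>: "\<zeta> = (p, q)" by (cases \<zeta>)
  then have pq: "- adjoint L q \<in> A p" "q \<in> B (L p)"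
    using assms by (auto simp: primal_dual_solutions_iff)
  define a b where "a = x (Suc n) - p" and "b = u (Suc n) - q"
  have xn: "x n - p = a - d n" and un: "u n - q = b - e n" and vn: "v n - q = b - \<Sigma> (L (d n))"
    by (simp_all add: a_def b_def d_def e_def u_Suc)
  have wn: "w n = e n - \<Sigma> (L (d n))" by (simp add: e_eq)
  have "0 \<le> inner a (- S (d n) - adjoint L (v n) - (- adjoint L q))"
    unfolding a_def by (rule maximally_monotoneD[OF A in_A' pq(1)])
  also have "\<dots> = - inner a (S (d n)) - inner (L a) (v n - q)"
    by (simp add: inner_diff_right inner_add_right adj)
  finally have 1: "0 \<le> - inner a (S (d n)) - inner (L a) (v n - q)" .
  have "0 \<le> inner (L (x (Suc n)) - T (e n) - L p) (v n - q)"
    by (rule maximally_monotoneD[OF B in_B' pq(2)])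
  also have "\<dots> = inner (L a) (v n - q) - inner (T (e n)) (v n - q)"
    by (simp add: a_def lin_simps inner_diff_left)
  also have "inner (T (e n)) (v n - q) = inner b (T (e n)) - inner (e n) (L (d n))"
    unfolding vn inner_commute[of "T (e n)"]
    by (simp add: inner_diff_left T_Sigma_inner inner_commute[of "L (d n)" "e n"])
  finally have 2: "0 \<le> inner (L a) (v n - q) - (inner b (T (e n)) - inner (e n) (L (d n)))" .
  \<comment> \<open>Expanding \<open>w n = e n - \<Sigma> (L (d n))\<close> yields a term in
    \<open>L (d n)\<close> that cancels the negative part of \<open>Q (d n)\<close>.\<close>
  have \<delta>: "\<delta> n = inner (d n) (S (d n)) + inner (e n) (T (e n)) - 2 * inner (e n) (L (d n))"
    using T_Sigma_inner[of "L (d n)" "e n"]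
    by (simp add: \<delta>_def Q_def wn lin_simps inner_diff_left inner_diff_right T_Sigma inner_commute)
  have X: "inner (X n - \<zeta>) (P (X n - \<zeta>)) =
      inner (a - d n) (S (a - d n)) + inner (b - e n) (T (b - e n))"
    by (simp add: X_def \<zeta> P_def inner_prod_def xn un)
  have X': "inner (X (Suc n) - \<zeta>) (P (X (Suc n) - \<zeta>)) = inner a (S a) + inner b (T b)"
    by (simp add: X_def \<zeta> P_def inner_prod_def a_def b_def)
  show ?thesis
    unfolding X X' \<delta> using 1 2 symS[of a "d n"] symT[of b "e n"]
    by (simp add: lin_simps inner_diff_left inner_diff_right)
qed

lemma P: "self_adjoint_linear P" "strongly_monotone P"
  using self_adjoint_linear_Pair[OF S(1) T(1)] strongly_monotone_Pair[OF S(2) T(2)]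
  unfolding P_def by auto

lemma summable_\<delta>:
  assumes "primal_dual_solutions A B L \<noteq> {}"
  shows "summable \<delta>"
proof -
  obtain \<zeta> where \<zeta>: "\<zeta> \<in> primal_dual_solutions A B L" using assms by blast
  define V where "V n = inner (X n - \<zeta>) (P (X n - \<zeta>))" for n
  obtain \<beta> where \<beta>: "\<beta> > 0" "\<And>p. \<beta> * (norm p)\<^sup>2 \<le> inner p (P p)"
    using P(2) by (rule strongly_monotoneE) blast
  have V_nonneg: "0 \<le> V n" for n
    using \<beta>(1) \<beta>(2)[of "X n - \<zeta>"] unfolding V_def
    by (meson less_imp_le mult_nonneg_nonneg order_trans zero_le_power2)
  have *: "V n + sum \<delta> {..<n} \<le> V 0" for n
  proof (induction n)
    case (Suc n)
    then show ?case using fejer[OF \<zeta>, of n] by (simp add: V_def)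
  qed simp
  then have "sum \<delta> {..<n} \<le> V 0" for n using V_nonneg[of n] *[of n] by linarith
  then show ?thesis using \<delta>_nonneg by (intro summableI_nonneg_bounded)
qed

text \<open>The form \<open>Q\<close> may be degenerate, so the Fejer estimate does not control \<open>d\<close>;
  monotonicity of \<open>A\<close> between consecutive iterates does.\<close>

lemma consecutive:
  "inner (d (Suc n)) (S (d (Suc n))) \<le>
     (Q (d n) + Q (d (Suc n))) / 2 - inner (L (d (Suc n))) (w (Suc n))"
proof -
  have v_diff: "v (Suc n) - v n = w (Suc n) + \<Sigma> (L (d n))"
    by (simp add: w_def d_def u_Suc)
  let ?d = "d (Suc n)"
  have "0 \<le> inner ?d ((- S ?d - adjoint L (v (Suc n))) - (- S (d n) - adjoint L (v n)))"
    unfolding d_def[of "Suc n"] by (rule maximally_monotoneD[OF A in_A'[unfolded d_def] in_A'])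
  also have "\<dots> = - inner ?d (S ?d) + inner ?d (S (d n)) - inner (L ?d) (v (Suc n) - v n)"
    by (simp add: inner_diff_right inner_add_right adj)
  finally have 1: "inner ?d (S ?d) \<le> inner ?d (S (d n)) - inner (L ?d) (w (Suc n)) - inner (L ?d) (\<Sigma> (L (d n)))"
    unfolding v_diff by (simp add: inner_add_right)
  \<comment> \<open>Nonnegativity of \<open>Q\<close> on a difference is Young's inequality for its
    bilinear form, valid even when \<open>Q\<close> is degenerate.\<close>
  have "0 \<le> Q (?d - d n)" by (rule Q_nonneg)
  also have "Q (?d - d n) = Q ?d + Q (d n) - 2 * (inner ?d (S (d n)) - inner (L ?d) (\<Sigma> (L (d n))))"
    using symS[of ?d "d n"] symSigma[of "L ?d" "L (d n)"]
    by (simp add: Q_def lin_simps inner_diff_left inner_diff_right)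
  finally show ?thesis using 1 by (simp add: field_simps)
qed

text \<open>The decrement controls \<open>w\<close> through strong monotonicity of \<open>T\<close>;
  \<open>consecutive\<close> then controls \<open>d\<close>, and \<open>e\<close> follows from
  \<open>e_eq\<close>.\<close>

lemma summable_differences:
  assumes "primal_dual_solutions A B L \<noteq> {}"
  shows "summable (\<lambda>n. (norm (d n))\<^sup>2)" "summable (\<lambda>n. (norm (e n))\<^sup>2)" "summable (\<lambda>n. (norm (w n))\<^sup>2)"
proof -
  note sum_\<delta> = summable_\<delta>[OF assms]
  obtain \<gamma> where \<gamma>: "\<gamma> > 0" "\<And>p. \<gamma> * (norm p)\<^sup>2 \<le> inner p (S p)"
    using S(2) by (rule strongly_monotoneE) blast
  obtain \<tau> where \<tau>: "\<tau> > 0" "\<And>p. \<tau> * (norm p)\<^sup>2 \<le> inner p (T p)"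
    using T(2) by (rule strongly_monotoneE) blast
  obtain K where K: "K > 0" "\<And>p. norm (L p) \<le> norm p * K"
    using bounded_linear.pos_bounded[OF L] by blast
  obtain M where M: "M > 0" "\<And>p. norm (\<Sigma> p) \<le> norm p * M"
    using bounded_linear.pos_bounded[OF Hellinger_Toeplitz[OF Sigma]] by blast
  have w_le: "(norm (w n))\<^sup>2 \<le> \<delta> n / \<tau>" for n
    using \<tau>(1) \<tau>(2)[of "w n"] Q_nonneg[of "d n"] by (simp add: \<delta>_def field_simps)
  show sum_w: "summable (\<lambda>n. (norm (w n))\<^sup>2)"
    by (rule summable_comparison_test'[OF summable_divide[OF sum_\<delta>, of \<tau>], of 0]) (use w_le in simp)
  have Q_le: "Q (d n) \<le> \<delta> n" for n using T_nonneg[of "w n"] by (simp add: \<delta>_def)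
  have d_le: "(norm (d (Suc n)))\<^sup>2 \<le> (\<delta> n + \<delta> (Suc n)) / \<gamma> + K\<^sup>2 / \<gamma>\<^sup>2 * (norm (w (Suc n)))\<^sup>2" for n
  proof -
    let ?r = "norm (d (Suc n))" and ?s = "norm (w (Suc n))"
    have "- inner (L (d (Suc n))) (w (Suc n)) \<le> norm (L (d (Suc n))) * ?s"
      using Cauchy_Schwarz_ineq2[of "L (d (Suc n))" "w (Suc n)"] by linarith
    also have "\<dots> \<le> ?r * K * ?s" by (intro mult_right_mono K(2)) simp
    finally have 1: "\<gamma> * ?r\<^sup>2 \<le> (\<delta> n + \<delta> (Suc n)) / 2 + ?r * K * ?s"
      using consecutive[of n] \<gamma>(2)[of "d (Suc n)"] Q_le[of n] Q_le[of "Suc n"] by argo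
    \<comment> \<open>This square absorbs the product \<open>?r * K * ?s\<close> into the left side,
      which is where the factor \<open>K\<^sup>2 / \<gamma>\<^sup>2\<close> comes from.\<close>
    have "0 \<le> (\<gamma> * ?r - K * ?s)\<^sup>2" by simp
    then have "2 * \<gamma> * (?r * K * ?s) \<le> \<gamma>\<^sup>2 * ?r\<^sup>2 + K\<^sup>2 * ?s\<^sup>2"
      by (simp add: power2_eq_square algebra_simps)
    moreover have "2 * \<gamma> * (\<gamma> * ?r\<^sup>2) \<le> 2 * \<gamma> * ((\<delta> n + \<delta> (Suc n)) / 2 + ?r * K * ?s)"
      using \<gamma>(1) 1 by (intro mult_left_mono) auto
    ultimately have "\<gamma>\<^sup>2 * ?r\<^sup>2 \<le> \<gamma> * (\<delta> n + \<delta> (Suc n)) + K\<^sup>2 * ?s\<^sup>2"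
      by (simp add: power2_eq_square field_simps)
    then show ?thesis using \<gamma>(1) by (simp add: power2_eq_square field_simps)
  qed
  have "summable (\<lambda>n. (\<delta> n + \<delta> (Suc n)) / \<gamma> + K\<^sup>2 / \<gamma>\<^sup>2 * (norm (w (Suc n)))\<^sup>2)"
    by (intro summable_add summable_divide summable_mult sum_\<delta>
        summable_ignore_initial_segment[OF sum_\<delta>, of 1, simplified]
        summable_ignore_initial_segment[OF sum_w, of 1, simplified])
  then have "summable (\<lambda>n. (norm (d (Suc n)))\<^sup>2)"
    by (rule summable_comparison_test'[of _ 0]) (use d_le in simp)
  then show sum_d: "summable (\<lambda>n. (norm (d n))\<^sup>2)"
    by (simp add: summable_Suc_iff[of "\<lambda>n. (norm (d n))\<^sup>2"])
  have e_le: "(norm (e n))\<^sup>2 \<le> 2 * (K * M)\<^sup>2 * (norm (d n))\<^sup>2 + 2 * (norm (w n))\<^sup>2" for n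
  proof -
    have "norm (\<Sigma> (L (d n))) \<le> norm (d n) * K * M"
      using M(2)[of "L (d n)"] mult_right_mono[OF K(2)[of "d n"], of M] M(1) by linarith
    then have "norm (e n) \<le> norm (d n) * K * M + norm (w n)"
      unfolding e_eq using norm_triangle_ineq[of "\<Sigma> (L (d n))" "w n"] by linarith
    then have "(norm (e n))\<^sup>2 \<le> (norm (d n) * K * M + norm (w n))\<^sup>2"
      by (intro power_mono) auto
    also have "\<dots> \<le> 2 * (norm (d n) * K * M)\<^sup>2 + 2 * (norm (w n))\<^sup>2"
      using zero_le_power2[of "norm (d n) * K * M - norm (w n)"] unfolding power2_sum power2_diff by linarith
    finally show ?thesis by (simp add: power_mult_distrib algebra_simps)
  qed
  have "summable (\<lambda>n. 2 * (K * M)\<^sup>2 * (norm (d n))\<^sup>2 + 2 * (norm (w n))\<^sup>2)"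
    by (intro summable_add summable_mult sum_d sum_w)
  then show "summable (\<lambda>n. (norm (e n))\<^sup>2)"
    by (rule summable_comparison_test'[of _ 0]) (use e_le in simp)
qed

text \<open>Testing both inclusions against arbitrary graph points and adding cancels
  \<open>inner (L (x (Suc n))) (v n)\<close>, a product of two merely weakly convergent sequences.
  Every other term has a limit along \<open>F\<close>, and maximality turns the limit inequality
  into the two inclusions.\<close>

lemma weak_cluster_points:
  assumes Z: "primal_dual_solutions A B L \<noteq> {}"
    and F: "F \<le> sequentially" "F \<noteq> bot" "\<And>y. ((\<lambda>n. inner (X n) y) \<longlongrightarrow> inner \<zeta> y) F"
  shows "\<zeta> \<in> primal_dual_solutions A B L"
proof -
  obtain p q where \<zeta>: "\<zeta> = (p, q)" by (cases \<zeta>)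
  obtain \<eta> where \<eta>: "\<eta> \<in> primal_dual_solutions A B L" using Z by blast
  have "inner (X (Suc n) - \<eta>) (P (X (Suc n) - \<eta>)) \<le> inner (X n - \<eta>) (P (X n - \<eta>))" for n
    using fejer[OF \<eta>, of n] \<delta>_nonneg[of n] by linarith
  then obtain K where K: "\<And>n. norm (X n) \<le> K" by (rule fejer_bounded[OF P(2)]) blast
  have xK: "norm (x n) \<le> K" and uK: "norm (u n) \<le> K" for n
    using K[of n] norm_fst_le[of "x n" "u n"] norm_snd_le[of "u n" "x n"]
    unfolding X_def by (meson order_trans)+
  note sums = summable_differences[OF Z, THEN summable_norm_square_tendsto_zero, THEN tendsto_mono[OF F(1)]]
  note d0 = sums(1) and e0 = sums(2) and w0 = sums(3)
  have Sd0: "((\<lambda>n. S (d n)) \<longlongrightarrow> 0) F"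
    using bounded_linear.tendsto[OF Hellinger_Toeplitz[OF S(1)] d0] by (simp add: lins[THEN linear_0])
  have Te0: "((\<lambda>n. T (e n)) \<longlongrightarrow> 0) F"
    using bounded_linear.tendsto[OF Hellinger_Toeplitz[OF T(1)] e0] by (simp add: lins[THEN linear_0])
  have x_lim: "((\<lambda>n. inner (x n) y) \<longlongrightarrow> inner p y) F" for y
    using F(3)[of "(y, 0)"] by (simp add: X_def \<zeta> inner_prod_def)
  have u_lim: "((\<lambda>n. inner (u n) y) \<longlongrightarrow> inner q y) F" for y
    using F(3)[of "(0, y)"] by (simp add: X_def \<zeta> inner_prod_def)
  have x'_lim: "((\<lambda>n. inner (x (Suc n)) y) \<longlongrightarrow> inner p y) F" for y
    using tendsto_add[OF x_lim tendsto_inner[OF d0 tendsto_const], of y y]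
    by (simp add: d_def inner_diff_left)
  have v_lim: "((\<lambda>n. inner (v n) y) \<longlongrightarrow> inner q y) F" for y
    using tendsto_add[OF u_lim tendsto_inner[OF w0 tendsto_const], of y y]
    by (simp add: w_def inner_diff_left)
  have xSd: "((\<lambda>n. inner (x (Suc n)) (S (d n))) \<longlongrightarrow> 0) F"
    by (rule tendsto_inner_bounded_zero[OF xK Sd0])
  have vTe: "((\<lambda>n. inner (v n) (T (e n))) \<longlongrightarrow> 0) F"
  proof -
    have "((\<lambda>n. inner (u n) (T (e n)) + inner (w n) (T (e n))) \<longlongrightarrow> 0 + inner 0 (0::'b)) F"
      by (intro tendsto_add tendsto_inner w0 Te0 tendsto_inner_bounded_zero[OF uK])
    then show ?thesis by (simp add: w_def inner_diff_left)
  qed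
  \<comment> \<open>The terms of \<open>?lhs\<close> pair a weakly convergent sequence with a fixed
    vector, a bounded one with a strongly null one, or are constant or strongly null.\<close>
  have rel: "0 \<le> inner (p - y) (- adjoint L q - a) + inner (L p - r) (q - b)"
    if "a \<in> A y" "b \<in> B r" for y a r b
  proof -
    let ?lhs = "\<lambda>n. inner (x (Suc n) - y) (- S (d n) - adjoint L (v n) - a) +
      inner (L (x (Suc n)) - T (e n) - r) (v n - b)"
    have eq: "?lhs n = - inner (x (Suc n)) (S (d n)) - inner (v n) (T (e n)) - inner (x (Suc n)) a
      + inner y (S (d n)) + inner (v n) (L y) + inner y a - inner (x (Suc n)) (adjoint L b)
      + inner (T (e n)) b - inner (v n) r + inner r b" for n
      by (simp add: inner_diff_left inner_diff_right adj adj' inner_commute algebra_simps)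
    have "(?lhs \<longlongrightarrow> - 0 - 0 - inner p a + inner y 0 + inner q (L y) + inner y a
      - inner p (adjoint L b) + inner 0 b - inner q r + inner r b) F"
      unfolding eq by (intro tendsto_intros xSd vTe x'_lim v_lim Sd0 Te0)
    moreover have "0 \<le> ?lhs n" for n
      by (intro add_nonneg_nonneg maximally_monotoneD[OF A in_A' that(1)] maximally_monotoneD[OF B in_B' that(2)])
    ultimately have "0 \<le> - 0 - 0 - inner p a + inner y 0 + inner q (L y) + inner y a
      - inner p (adjoint L b) + inner 0 b - inner q r + inner r b"
      using F(2) by (intro tendsto_lowerbound[of ?lhs _ F]) auto
    then show ?thesis
      by (simp add: inner_diff_left inner_diff_right adj lin_simps inner_commute algebra_simps)
  qed
  \<comment> \<open>Separating the sum: if the first inclusion failed, some \<open>(y, a)\<close>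
    would make the first term negative and hence the second positive for every
    \<open>(r, b)\<close>. Maximality of \<open>B\<close> would then admit \<open>r = L p\<close>,
    \<open>b = q\<close>, where that term is 0.\<close>
  have inA: "- adjoint L q \<in> A p"
  proof (rule ccontr)
    assume "- adjoint L q \<notin> A p"
    then obtain y a where ya: "a \<in> A y" "inner (p - y) (- adjoint L q - a) < 0"
      using maximally_monotone_memI[OF A, of p "- adjoint L q"] by (meson not_le)
    have *: "0 < inner (L p - r) (q - b)" if "b \<in> B r" for r b
      using rel[OF ya(1) that] ya(2) by linarith
    then have "q \<in> B (L p)"
      by (intro maximally_monotone_memI[OF B]) (simp add: less_imp_le)
    then show False using *[of q "L p"] by simp
  qed
  \<comment> \<open>The choice \<open>y = p\<close>, \<open>a = - adjoint L q\<close> removes the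
    first term of \<open>rel\<close>.\<close>
  moreover have "q \<in> B (L p)"
    using rel[OF inA] by (intro maximally_monotone_memI[OF B]) simp
  ultimately show ?thesis by (simp add: \<zeta> primal_dual_solutions_iff)
qed

theorem weak_convergence:
  assumes Z: "primal_dual_solutions A B L \<noteq> {}"
  shows "\<exists>\<zeta>\<in>primal_dual_solutions A B L. weakly_converges X \<zeta>"
proof (rule fejer_Opial[OF P Z])
  fix n \<zeta> assume "\<zeta> \<in> primal_dual_solutions A B L"
  then show "inner (X (Suc n) - \<zeta>) (P (X (Suc n) - \<zeta>)) \<le> inner (X n - \<zeta>) (P (X n - \<zeta>))"
    using fejer[of \<zeta> n] \<delta>_nonneg[of n] by linarith
qed (rule weak_cluster_points[OF Z])

end

section \<open>From the resolvent recurrence to the inclusions\<close>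

theorem theorem3p3:
  fixes A :: "'a::{real_inner, complete_space} \<Rightarrow> 'a set"
    and B :: "'b::{real_inner, complete_space} \<Rightarrow> 'b set"
    and L :: "'a \<Rightarrow> 'b"
    and \<Sigma> :: "'b \<Rightarrow> 'b"
    and \<Upsilon> :: "'a \<Rightarrow> 'a"
    and x z :: "nat \<Rightarrow> 'a"
    and u v :: "nat \<Rightarrow> 'b"
  assumes A: "maximally_monotone A"
    and B: "maximally_monotone B"
    and L: "bounded_linear L" "L \<noteq> (\<lambda>_. 0)"
    and Z: "primal_dual_solutions A B L \<noteq> {}"
    and Sigma: "self_adjoint_linear \<Sigma>" "strongly_monotone \<Sigma>"
    and Upsilon: "self_adjoint_linear \<Upsilon>" "strongly_monotone \<Upsilon>"
    and U: "monotone_operator (\<lambda>y. {inv \<Upsilon> y - adjoint L (\<Sigma> (L y))})"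
    and v: "\<And>n. v n = \<Sigma> ((L (x n) + inv \<Sigma> (u n))
                 - resolvent (\<lambda>y. inv \<Sigma> ` B y) (L (x n) + inv \<Sigma> (u n)))"
    and z: "\<And>n. z n = x n - \<Upsilon> (adjoint L (v n))"
    and x: "\<And>n. x (Suc n) = resolvent (\<lambda>y. \<Upsilon> ` A y) (z n)"
    and u: "\<And>n. u (Suc n) = \<Sigma> (L (x (Suc n) - x n)) + v n"
  shows "((\<lambda>n. (norm (x (n + 1) - x n))\<^sup>2) summable_on {1..} \<and>
          (\<lambda>n. (norm (u (n + 1) - u n))\<^sup>2) summable_on {1..}) \<and>
         (\<exists>(x', u') \<in> primal_dual_solutions A B L.
            weakly_converges (\<lambda>n. (x n, u n)) (x', u'))"
proof -
  define S T where "S = inv \<Upsilon>" and "T = inv \<Sigma>"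
  note S = self_adjoint_linear_inv[OF Upsilon, folded S_def] strongly_monotone_inv[OF Upsilon, folded S_def]
  note T = self_adjoint_linear_inv[OF Sigma, folded T_def] strongly_monotone_inv[OF Sigma, folded T_def]
  note bij = strongly_monotone_bij[OF Upsilon] strongly_monotone_bij[OF Sigma]
  have inv_simps: "S (\<Upsilon> a) = a" "T (\<Sigma> b) = b" "\<Sigma> (T b) = b" for a b
    using bij by (simp_all add: S_def T_def bij_def inv_f_f surj_f_inv_f)
  have inv_T: "inv T = \<Sigma>" unfolding T_def by (rule inv_inv_eq[OF bij(2)])
  note linS = self_adjoint_linearD(1)[OF S(1)] and linT = self_adjoint_linearD(1)[OF T(1)]
    and lin\<Sigma> = self_adjoint_linearD(1)[OF Sigma(1)] and linL = bounded_linear.linear[OF L(1)]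
  interpret split_douglas_rachford A B L \<Sigma> T S x u v
  proof (rule split_douglas_rachford.intro)
    show "inner (L p) (\<Sigma> (L p)) \<le> inner p (S p)" for p
    proof -
      have "0 \<le> inner (p - 0) ((S p - adjoint L (\<Sigma> (L p))) - (S 0 - adjoint L (\<Sigma> (L 0))))"
        using U unfolding monotone_operator_def S_def by blast
      then show ?thesis
        by (simp add: inner_diff_right inner_add_right inner_adjoint[OF L(1)] linear_0[OF linS] linear_0[OF lin\<Sigma>]
            linear_0[OF linL])
    qed
    show "S (x n - x (Suc n)) - adjoint L (v n) \<in> A (x (Suc n))" for n
    proof -
      have "S (z n - x (Suc n)) \<in> A (x (Suc n))"
        unfolding S_def x by (rule resolvent_mem[OF A Upsilon])
      moreover have "S (z n - x (Suc n)) = S (x n - x (Suc n)) - adjoint L (v n)"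
        by (simp add: z linear_diff[OF linS] inv_simps)
      ultimately show ?thesis by simp
    qed
    \<comment> \<open>Here the weight of the resolvent is \<open>T\<close>, whose inverse is
      \<Sigma>, so \<open>v n\<close> itself lies in \<open>B r\<close>; the update of
      \<open>u\<close> rewrites \<open>r = c - T (v n)\<close> through the new iterates.\<close>
    show "v n \<in> B (L (x (Suc n)) + T (u n - u (Suc n)))" for n
    proof -
      define c r where "c = L (x n) + T (u n)" and "r = resolvent (\<lambda>y. T ` B y) c"
      have vn: "v n = \<Sigma> (c - r)" by (simp add: v c_def r_def T_def)
      have "\<Sigma> (c - r) \<in> B r"
        unfolding r_def by (rule resolvent_mem[OF B T, unfolded inv_T])
      moreover have "T (v n) = c - r" by (simp add: vn inv_simps)
      then have "r = L (x (Suc n)) + T (u n - u (Suc n))"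
        by (simp add: u c_def linear_diff[OF linT] linear_add[OF linT] inv_simps
            linear_diff[OF linL] algebra_simps)
      ultimately show ?thesis by (simp add: vn)
    qed
  qed (use A B L S T Sigma inv_simps u in auto)
  have "(\<lambda>n. (norm (d n))\<^sup>2) summable_on {1..}" "(\<lambda>n. (norm (e n))\<^sup>2) summable_on {1..}"
    using summable_differences[OF Z] by (auto intro: summable_on_of_summable_nonneg)
  moreover obtain \<zeta> where "\<zeta> \<in> primal_dual_solutions A B L" "weakly_converges X \<zeta>"
    using weak_convergence[OF Z] by blast
  ultimately show ?thesis
    unfolding d_def e_def X_def by (cases \<zeta>) auto
qed

end
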